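(* Let $\mathcal{B}=(e_n)_{n=1}^\infty$ be a basis of an infinite-dimensional Banach space $\mathbb{X}$ over $\mathbb{K}=\mathbb{R}$ or $\mathbb{C}$. Then $\mathcal{B}$ is $1$-RPG2 with constant $1$ if and only if $\mathcal{B}$ is RPG with constant $1$.
   Context: $\mathbb{N}=\{1,2,\ldots\}$. A basis of $\mathbb{X}$ is a sequence $\mathcal{B}=(e_n)_{n=1}^\infty$ in $\mathbb{X}$ such that: (i) the linear span of $(e_n)_n$ is norm-dense in $\mathbb{X}$; (ii) there are biorthogonal functionals $(e_n^* )_n\subset\mathbb{X}^*$, i.e. $e_n^*(e_m)=\delta_{n,m}$; (iii) there are $c_1,c_2>0$ with $c_1\leqslant\|e_n\|,\|e_n^*\|\leqslant c_2$ for all $n$. (Totality of $(e_n^* )_n$ and the Schauder property are not assumed.) For a finite set $A\subset\mathbb{N}$, $P_A(x)=\sum_{n\in A}e_n^*(x)e_n$. A finite set $\Lambda\subset\mathbb{N}$ is a greedy set of $x$ if $\min_{n\in\Lambda}|e_n^*(x)|\geqslant\max_{n\notin\Lambda}|e_n^*(x)|$; $G(x,m)$ is the set of all greedy sets of $x$ of cardinality $m$. For sets $A,B\subset\mathbb{N}$, $A>B$ means $a>b$ for all $a\in A$, $b\in B$ (vacuously true if one of them is empty), and similarly for $<,\geqslant,\leqslant$; a number $k$ is treated as $\{k\}$. RPG with constant $1$ means: for all $x\in\mathbb{X}$, $m\in\mathbb{N}$, $\Lambda\in G(x,m)$, $$\|x-P_\Lambda(x)\|\leqslant\inf\{\|x-P_A(x)\|: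 A\subset\mathbb{N},\ |A|\leqslant m,\ A>\Lambda\}.$$ An interval is a set of consecutive positive integers. For $A\subset\mathbb{N}$, $$\check{\sigma}^{A}_m(x)=\inf\{\|x-P_I(x)\|:\ \text{either } I=\emptyset,\ \text{or } I \text{ is an interval with } A\leqslant\max I,\ |I|\leqslant m\}.$$ $1$-RPG2 with constant $1$ means: $\|x-P_\Lambda(x)\|\leqslant\check{\sigma}^{\Lambda}_m(x)$ for all $x\in\mathbb{X}$, $m\in\mathbb{N}$, $\Lambda\in G(x,m)$. *)

theory Defs
  imports "HOL-Analysis.Analysis"
begin

text \<open>
  A Banach space over the scalar field \<open>'k\<close> (used for \<open>real\<close> and \<open>complex\<close>): a real Banach space
  carrying a \<open>'k\<close>-vector space structure that extends the real one and is compatible with the norm.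
  For \<open>'k = real\<close> this forces \<open>smul = scaleR\<close>.
\<close>

locale banach_over = vector_space smul
  for smul :: "'k::real_normed_field \<Rightarrow> 'x::banach \<Rightarrow> 'x" +
  assumes norm_smul: "norm (smul c x) = norm c * norm x"
    and smul_of_real: "smul (of_real r) x = r *\<^sub>R x"

definition infinite_dimensional :: "('k::field \<Rightarrow> 'x::ab_group_add \<Rightarrow> 'x) \<Rightarrow> bool" where
  "infinite_dimensional smul \<longleftrightarrow> (\<nexists>B. finite_dimensional_vector_space smul B)"

definition dual_functional ::
  "('k::real_normed_field \<Rightarrow> 'x::real_normed_vector \<Rightarrow> 'x) \<Rightarrow> ('x \<Rightarrow> 'k) \<Rightarrow> bool" where
  "dual_functional smul f \<longleftrightarrow> bounded_linear f \<and> (\<forall>c x. f (smul c x) = c * f x)"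

text \<open>
  The basis vectors are indexed from \<open>0\<close> instead of \<open>1\<close>; all notions below are invariant under
  this shift. By density of the span, the biorthogonal functionals \<open>es\<close> are determined by \<open>e\<close>.
\<close>

locale basis_over = banach_over smul
  for smul :: "'k::real_normed_field \<Rightarrow> 'x::banach \<Rightarrow> 'x" +
  fixes e :: "nat \<Rightarrow> 'x" and es :: "nat \<Rightarrow> 'x \<Rightarrow> 'k"
  assumes span_dense: "closure (span (range e)) = UNIV"
    and dual: "dual_functional smul (es n)"
    and biorthogonal: "es n (e m) = (if n = m then 1 else 0)"
    and seminormalized: "\<exists>c1 c2. 0 < c1 \<and> 0 < c2 \<and>
          (\<forall>n. c1 \<le> norm (e n) \<and> norm (e n) \<le> c2 \<and> c1 \<le> onorm (es n) \<and> onorm (es n) \<le> c2)"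

definition proj ::
  "('k \<Rightarrow> 'x \<Rightarrow> 'x) \<Rightarrow> (nat \<Rightarrow> 'x) \<Rightarrow> (nat \<Rightarrow> 'x \<Rightarrow> 'k) \<Rightarrow> nat set \<Rightarrow> 'x::real_normed_vector \<Rightarrow> 'x" where
  "proj smul e es A x = (\<Sum>n\<in>A. smul (es n x) (e n))"

definition greedy_sets :: "(nat \<Rightarrow> 'x \<Rightarrow> 'k::real_normed_field) \<Rightarrow> 'x \<Rightarrow> nat \<Rightarrow> nat set set" where
  "greedy_sets es x m =
     {L. finite L \<and> card L = m \<and> (\<forall>n\<in>L. \<forall>k. k \<notin> L \<longrightarrow> norm (es n x) \<ge> norm (es k x))}"

definition RPG_const_1 ::
  "('k \<Rightarrow> 'x \<Rightarrow> 'x) \<Rightarrow> (nat \<Rightarrow> 'x) \<Rightarrow> (nat \<Rightarrow> 'x::real_normed_vector \<Rightarrow> 'k::real_normed_field) \<Rightarrow> bool" where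
  "RPG_const_1 smul e es \<longleftrightarrow>
     (\<forall>x. \<forall>m\<ge>1. \<forall>L\<in>greedy_sets es x m.
        norm (x - proj smul e es L x) \<le>
          Inf {norm (x - proj smul e es A x) | A.
                 finite A \<and> card A \<le> m \<and> (\<forall>a\<in>A. \<forall>l\<in>L. a > l)})"

text \<open>Nonempty finite intervals; infinite ones are excluded below by the bound on the cardinality.\<close>

definition nat_interval :: "nat set \<Rightarrow> bool" where
  "nat_interval I \<longleftrightarrow> (\<exists>a b. a \<le> b \<and> I = {a..b})"

definition sigma_check ::
  "('k \<Rightarrow> 'x \<Rightarrow> 'x) \<Rightarrow> (nat \<Rightarrow> 'x) \<Rightarrow> (nat \<Rightarrow> 'x \<Rightarrow> 'k) \<Rightarrow> nat set \<Rightarrow> nat \<Rightarrow> 'x::real_normed_vector \<Rightarrow> real" where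
  "sigma_check smul e es A m x =
     Inf {norm (x - proj smul e es I x) | I.
            I = {} \<or> (nat_interval I \<and> (\<forall>a\<in>A. a \<le> Max I) \<and> card I \<le> m)}"

definition one_RPG2_const_1 ::
  "('k \<Rightarrow> 'x \<Rightarrow> 'x) \<Rightarrow> (nat \<Rightarrow> 'x) \<Rightarrow> (nat \<Rightarrow> 'x::real_normed_vector \<Rightarrow> 'k::real_normed_field) \<Rightarrow> bool" where
  "one_RPG2_const_1 smul e es \<longleftrightarrow>
     (\<forall>x. \<forall>m\<ge>1. \<forall>L\<in>greedy_sets es x m.
        norm (x - proj smul e es L x) \<le> sigma_check smul e es L m x)"

end

theory Submission imports Defs
begin

text \<open>
  Greedy sets survive projections: if \<open>L\<close> is greedy for \<open>x\<close>, then \<open>L - D\<close> is greedy for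
  \<open>x - P\<^sub>D x\<close> (\<open>greedy_sets_residual\<close>). Both implications rest on applying the hypothesis
  to such a residual instead of to \<open>x\<close> itself.

  From RPG to RPG2, let \<open>I\<close> be an interval that reaches at least as far right as \<open>L\<close>. What is left
  of \<open>L\<close> outside \<open>I\<close> must lie entirely to the left of \<open>I\<close>, so after projecting away \<open>I \<inter> L\<close>
  the set \<open>I - L\<close> competes with \<open>L - I\<close> as RPG permits.

  From RPG2 to RPG, the competitor \<open>A\<close> need not be an interval, but every singleton is one. RPG2 for
  singletons says that deleting a largest coefficient \<open>l\<close> of a vector gives a norm no greater than
  deleting a coefficient further to the right, or nothing at all. Since the constant is \<open>1\<close>, this
  exchange can be iterated without loss: as all of \<open>A\<close> lies to the right of all of \<open>L\<close>, the
  elements of \<open>L\<close>, taken in order of decreasing coefficients, can be paired with those of \<open>A\<close>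
  in any way, and the unpaired ones can simply be restored.
\<close>

lemma RPG_const_1_iff:
  "RPG_const_1 smul e es \<longleftrightarrow>
     (\<forall>x m L A. m \<ge> 1 \<longrightarrow> L \<in> greedy_sets es x m \<longrightarrow>
        finite A \<longrightarrow> card A \<le> m \<longrightarrow> (\<forall>a\<in>A. \<forall>l\<in>L. a > l) \<longrightarrow>
        norm (x - proj smul e es L x) \<le> norm (x - proj smul e es A x))"
proof -
  have "norm (x - proj smul e es L x) \<le>
          Inf {norm (x - proj smul e es A x) | A.
                 finite A \<and> card A \<le> m \<and> (\<forall>a\<in>A. \<forall>l\<in>L. a > l)} \<longleftrightarrow>
        (\<forall>A. finite A \<longrightarrow> card A \<le> m \<longrightarrow> (\<forall>a\<in>A. \<forall>l\<in>L. a > l) \<longrightarrow>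
           norm (x - proj smul e es L x) \<le> norm (x - proj smul e es A x))"
    (is "?n \<le> Inf ?S \<longleftrightarrow> _") for x m L
  proof -
    have "?S \<noteq> {}"
      by (auto intro!: exI[of _ "{}"])
    moreover have "bdd_below ?S"
      by (rule bdd_belowI[of _ 0]) auto
    ultimately show ?thesis
      by (subst le_cInf_iff) auto
  qed
  then show ?thesis
    by (simp only: RPG_const_1_def) blast
qed

lemma one_RPG2_const_1_iff:
  "one_RPG2_const_1 smul e es \<longleftrightarrow>
     (\<forall>x m L I. m \<ge> 1 \<longrightarrow> L \<in> greedy_sets es x m \<longrightarrow>
        I = {} \<or> nat_interval I \<and> (\<forall>l\<in>L. l \<le> Max I) \<and> card I \<le> m \<longrightarrow>
        norm (x - proj smul e es L x) \<le> norm (x - proj smul e es I x))"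
proof -
  have "norm (x - proj smul e es L x) \<le> sigma_check smul e es L m x \<longleftrightarrow>
        (\<forall>I. I = {} \<or> nat_interval I \<and> (\<forall>l\<in>L. l \<le> Max I) \<and> card I \<le> m \<longrightarrow>
           norm (x - proj smul e es L x) \<le> norm (x - proj smul e es I x))" for x m L
  proof -
    let ?S = "{norm (x - proj smul e es I x) | I.
            I = {} \<or> (nat_interval I \<and> (\<forall>a\<in>L. a \<le> Max I) \<and> card I \<le> m)}"
    have "?S \<noteq> {}"
      by auto
    moreover have "bdd_below ?S"
      by (rule bdd_belowI[of _ 0]) auto
    ultimately show ?thesis
      unfolding sigma_check_def by (subst le_cInf_iff) blast+
  qed
  then show ?thesis
    by (simp only: one_RPG2_const_1_def) blast
qed

context basis_over
begin

lemma linear_coefficient: "linear (es n)"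
  using dual[of n] by (simp add: dual_functional_def bounded_linear.linear)

lemma coefficient_smul: "es n (smul c x) = c * es n x"
  using dual[of n] by (simp add: dual_functional_def)

lemma coefficient_residual:
  assumes "finite D"
  shows "es n (x - proj smul e es D x) = (if n \<in> D then 0 else es n x)"
proof -
  have "es n (proj smul e es D x) = (\<Sum>k\<in>D. es k x * (if n = k then 1 else 0))"
    by (simp add: proj_def linear_sum[OF linear_coefficient] coefficient_smul biorthogonal)
  also have "\<dots> = (\<Sum>k\<in>D. if n = k then es k x else 0)"
    by (rule sum.cong) auto
  also have "\<dots> = (if n \<in> D then es n x else 0)"
    using assms by simp
  finally show ?thesis
    by (simp add: linear_diff[OF linear_coefficient])
qed

lemma proj_residual:
  assumes "finite D" "A \<inter> D = {}"
  shows "proj smul e es A (x - proj smul e es D x) = proj smul e es A x"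
  unfolding proj_def
proof (rule sum.cong)
  fix n assume "n \<in> A"
  with assms have "n \<notin> D" by auto
  with assms(1) show "smul (es n (x - (\<Sum>n\<in>D. smul (es n x) (e n)))) (e n) = smul (es n x) (e n)"
    using coefficient_residual[of D n x] by (simp add: proj_def)
qed simp

lemma residual_residual:
  assumes "finite D" "finite A" "A \<inter> D = {}"
  shows "x - proj smul e es D x - proj smul e es A (x - proj smul e es D x) =
         x - proj smul e es (D \<union> A) x"
proof -
  have "D \<inter> A = {}"
    using assms(3) by blast
  then have "proj smul e es (D \<union> A) x = proj smul e es D x + proj smul e es A x"
    using assms(1,2) by (simp add: proj_def sum.union_disjoint)
  then show ?thesis
    using proj_residual[OF assms(1,3)] by simp
qed

lemma greedy_sets_residual:
  assumes "L \<in> greedy_sets es x m" "finite D"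
  shows "L - D \<in> greedy_sets es (x - proj smul e es D x) (card (L - D))"
  using assms by (auto simp: greedy_sets_def coefficient_residual)

text \<open>
  Both vectors compared below are residuals of \<open>y = x - P\<^bsub>I \<inter> L\<^esub> x\<close>, by the sets \<open>L - I\<close> and
  \<open>I - L\<close>, and the latter has at most as many elements as the former.
\<close>

lemma RPG_imp_one_RPG2:
  assumes "RPG_const_1 smul e es"
  shows "one_RPG2_const_1 smul e es"
  unfolding one_RPG2_const_1_iff
proof (intro allI impI)
  fix x m L I
  assume m: "m \<ge> 1" and L: "L \<in> greedy_sets es x m"
    and I: "I = {} \<or> nat_interval I \<and> (\<forall>l\<in>L. l \<le> Max I) \<and> card I \<le> m"
  have fin: "finite L" "finite I" and card_L: "card L = m" and card_I: "card I \<le> m"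
    using L I by (auto simp: greedy_sets_def nat_interval_def)
  have right: "\<forall>a\<in>I - L. \<forall>l\<in>L - I. a > l"
  proof (intro ballI)
    fix a l assume a: "a \<in> I - L" and l: "l \<in> L - I"
    then obtain b c where I_eq: "b \<le> c" "I = {b..c}" and "l \<le> Max I"
      using I by (auto simp: nat_interval_def)
    have "Max {b..c} \<in> {b..c}"
      using I_eq(1) by (intro Max_in) auto
    then have "l \<le> c"
      using \<open>l \<le> Max I\<close> I_eq(2) by simp
    with a l I_eq show "a > l"
      by auto
  qed
  define y where "y = x - proj smul e es (I \<inter> L) x"
  have y_L: "y - proj smul e es (L - I) y = x - proj smul e es L x"
    unfolding y_def using fin
    by (subst residual_residual) (auto intro!: arg_cong[where f = "\<lambda>A. proj smul e es A x"])
  have y_I: "y - proj smul e es (I - L) y = x - proj smul e es I x"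
    unfolding y_def using fin
    by (subst residual_residual) (auto intro!: arg_cong[where f = "\<lambda>A. proj smul e es A x"])
  have le: "card (I - L) \<le> card (L - I)"
    using fin card_L card_I by (simp add: card_le_sym_Diff)
  show "norm (x - proj smul e es L x) \<le> norm (x - proj smul e es I x)"
  proof (cases "L - I = {}")
    case True
    then have "I - L = {}"
      using le fin by (metis card.empty card_0_eq finite_Diff le_zero_eq)
    with True have "I = L"
      by blast
    then show ?thesis
      by simp
  next
    case False
    then have "card (L - I) \<ge> 1"
      using fin by (simp add: Suc_le_eq card_gt_0_iff)
    moreover have "L - I \<in> greedy_sets es y (card (L - I))"
      using greedy_sets_residual[OF L, of "I \<inter> L"] fin by (simp add: y_def Diff_Int)
    ultimately have "norm (y - proj smul e es (L - I) y) \<le> norm (y - proj smul e es (I - L) y)"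
      using assms[unfolded RPG_const_1_iff] le right fin by blast
    then show ?thesis
      by (simp only: y_L y_I)
  qed
qed

text \<open>
  This is RPG2 for greedy sets of size \<open>1\<close>: the singleton of any index to the right of \<open>l\<close> is an
  admissible interval, and so is the empty set, which amounts to restoring \<open>l\<close>.
\<close>

lemma one_RPG2_exchange:
  assumes "one_RPG2_const_1 smul e es"
    and "\<And>k. norm (es k u) \<le> norm (es l u)"
    and "B = {} \<or> (\<exists>a>l. B = {a})"
  shows "norm (u - proj smul e es {l} u) \<le> norm (u - proj smul e es B u)"
proof -
  have "{l} \<in> greedy_sets es u 1"
    using assms(2) by (simp add: greedy_sets_def)
  moreover have "B = {} \<or> nat_interval B \<and> (\<forall>k\<in>{l}. k \<le> Max B) \<and> card B \<le> 1"
  proof -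
    have "nat_interval {a}" for a
      unfolding nat_interval_def by (rule exI[of _ a], rule exI[of _ a]) simp
    then show ?thesis
      using assms(3) by auto
  qed
  ultimately show ?thesis
    using assms(1)[unfolded one_RPG2_const_1_iff] by blast
qed

text \<open>
  Induction on the size of the greedy set. A largest coefficient \<open>l\<close> of \<open>x\<close> is split off from \<open>L\<close>,
  and an arbitrary element (if any) from \<open>A\<close>. The induction hypothesis replaces the remainder of
  \<open>L\<close> by the remainder \<open>A'\<close> of \<open>A\<close> in the residual of \<open>l\<close>; the exchange step is then
  applied to the residual of \<open>A'\<close>, where \<open>l\<close> still carries a largest coefficient.
\<close>

lemma one_RPG2_greedy_le:
  assumes "one_RPG2_const_1 smul e es"
    and "L \<in> greedy_sets es x m" "finite A" "card A \<le> m" "\<forall>a\<in>A. \<forall>l\<in>L. a > l"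
  shows "norm (x - proj smul e es L x) \<le> norm (x - proj smul e es A x)"
  using assms(2-)
proof (induction m arbitrary: x L A)
  case 0
  then show ?case
    by (auto simp: greedy_sets_def)
next
  case (Suc m)
  have L: "finite L" "card L = Suc m"
    using Suc.prems(1) by (auto simp: greedy_sets_def)
  then have "L \<noteq> {}"
    by auto
  then have "Max ((\<lambda>k. norm (es k x)) ` L) \<in> (\<lambda>k. norm (es k x)) ` L"
    using L(1) by (intro Max_in) auto
  then obtain l where l: "l \<in> L" and l_Max: "Max ((\<lambda>k. norm (es k x)) ` L) = norm (es l x)"
    by blast
  have max_L: "norm (es k x) \<le> norm (es l x)" if "k \<in> L" for k
    unfolding l_Max[symmetric] using L(1) that by (intro Max_ge) auto
  have max: "norm (es k x) \<le> norm (es l x)" for k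
    using max_L[of k] Suc.prems(1) l by (cases "k \<in> L") (auto simp: greedy_sets_def)
  have l_A: "l \<notin> A"
    using Suc.prems(4) l by auto
  obtain B where B: "B \<subseteq> A" "B = {} \<or> (\<exists>a>l. B = {a})" "card (A - B) \<le> m"
  proof (cases "A = {}")
    case True
    then show ?thesis
      using that[of "{}"] by simp
  next
    case False
    then obtain a where "a \<in> A"
      by blast
    then show ?thesis
      using that[of "{a}"] Suc.prems(2,3,4) l by (auto simp: card_Diff_singleton)
  qed
  define A' where "A' = A - B"
  have fin: "finite A'" "finite B"
    using Suc.prems(2) B(1) by (auto simp: A'_def intro: finite_subset)
  define y where "y = x - proj smul e es {l} x"
  define u where "u = x - proj smul e es A' x"
  have "norm (x - proj smul e es L x) = norm (y - proj smul e es (L - {l}) y)"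
    unfolding y_def using L(1) l by (subst residual_residual) (auto simp: insert_absorb)
  also have "\<dots> \<le> norm (y - proj smul e es A' y)"
  proof (rule Suc.IH)
    show "L - {l} \<in> greedy_sets es y m"
      using greedy_sets_residual[OF Suc.prems(1), of "{l}"] L l
      by (simp add: y_def card_Diff_singleton)
  qed (use fin B(3) Suc.prems(4) in \<open>auto simp: A'_def\<close>)
  also have "y - proj smul e es A' y = u - proj smul e es {l} u"
    unfolding y_def u_def using fin l_A
    by (subst (1 2) residual_residual) (auto simp: A'_def)
  also have "norm \<dots> \<le> norm (u - proj smul e es B u)"
  proof (rule one_RPG2_exchange[OF assms(1) _ B(2)])
    show "norm (es k u) \<le> norm (es l u)" for k
      using max[of k] fin l_A by (simp add: u_def coefficient_residual A'_def)
  qed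
  also have "u - proj smul e es B u = x - proj smul e es A x"
    unfolding u_def using fin B(1)
    by (subst residual_residual) (auto simp: A'_def Un_absorb2)
  finally show ?case .
qed

lemma one_RPG2_iff_RPG: "one_RPG2_const_1 smul e es \<longleftrightarrow> RPG_const_1 smul e es"
  using RPG_imp_one_RPG2 one_RPG2_greedy_le unfolding RPG_const_1_iff[of smul] by blast

end

theorem corollary1p5:
  shows "(\<forall>(smul :: real \<Rightarrow> 'x::banach \<Rightarrow> 'x) e es.
            infinite_dimensional smul \<longrightarrow> basis_over smul e es \<longrightarrow>
              (one_RPG2_const_1 smul e es \<longleftrightarrow> RPG_const_1 smul e es)) \<and>
         (\<forall>(smul :: complex \<Rightarrow> 'y::banach \<Rightarrow> 'y) e es.
            infinite_dimensional smul \<longrightarrow> basis_over smul e es \<longrightarrow>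
              (one_RPG2_const_1 smul e es \<longleftrightarrow> RPG_const_1 smul e es))"
  by (intro conjI allI impI; rule basis_over.one_RPG2_iff_RPG)

end
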